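(* Let $n\ge1$. The Chevalley basis elements for $sp(2n)$, the vector $E_{-2,-2}-E_{-1,-1}$ in $so(2)$, together with the odd root vectors, for $1\le j\le n$, $$X_{\delta_{-1}+\delta_j}=E_{-2,j+n}+E_{j,-1},\qquad X_{-\delta_{-1}-\delta_j}=E_{j+n,-2}-E_{-1,j},$$ $$X_{\delta_{-1}-\delta_j}=E_{-2,j}-E_{j+n,-1},\qquad X_{-\delta_{-1}+\delta_j}=E_{-1,j+n}+E_{j,-2},$$ form a basis for the Lie superalgebra $spo(2n|2)$ (realized as $osp(2|2n)$) with integer structure constants.
   Context: The base field has characteristic different from $2$. The Lie superalgebra $spo(2n|2)$ is realized as $osp(2|2n)$, the Lie superalgebra (under the supercommutator) of matrices, with rows and columns indexed by $\{-2,-1;1,2,\dots,2n\}$, of the $(1|1|n|n)$-block form $$\begin{pmatrix}a&0&x&x_1\\ 0&-a&y&y_1\\ y_1^t&x_1^t&d&e\\ -y^t&-x^t&f&-d^t\end{pmatrix}$$ with $e,f$ symmetric. The even part consists of the matrices with $x=x_1=y=y_1=0$ and is $so(2)\oplus sp(2n)$; the odd part consists of those with $a=0$ and $d=e=f=0$. The diagonal matrices form the Cartan subalgebra, with basis $E_{-2,-2}-E_{-1,-1}$, $E_{i,i}-E_{n+i,n+i}$ ($1\le i\le n$) and dual basis $\delta_{-1},\delta_1,\dots,\delta_n$. $E_{a,b}$ are matrix units. The Chevalley basis of $sp(2n)$ is the usual one (unique up to signs) for the simple roots $\delta_i-\delta_{i+1}$ ($1\le i<n$), $2\delta_n$: the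 simple coroot elements, and root vectors $E_{i,j}-E_{j+n,i+n}$ ($i\ne j$), $E_{i,j+n}+E_{j,i+n}$ and $E_{i+n,j}+E_{j+n,i}$ ($i<j$), $E_{i,i+n}$, $E_{i+n,i}$. Integer structure constants means that the superbracket of any two basis elements is a $\mathbb Z$-linear combination of basis elements. *)

theory Defs
  imports "HOL-Analysis.Analysis"
begin

text \<open>
  The number \<open>n \<ge> 1\<close> is \<open>CARD('n)\<close> for a finite linearly ordered type \<open>'n\<close>, which plays the
  role of \<open>{1,...,n}\<close>. Rows and columns are indexed by \<open>-2\<close>, \<open>-1\<close> (\<open>M2\<close>, \<open>M1\<close>) and by
  \<open>i\<close>, \<open>n + i\<close> (\<open>Lo i\<close>, \<open>Hi i\<close>) for \<open>i\<close> in \<open>'n\<close>.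
\<close>

datatype 'n idx = M2 | M1 | Lo 'n | Hi 'n

lemma UNIV_idx: "(UNIV :: 'n idx set) = {M2, M1} \<union> range Lo \<union> range Hi"
proof -
  have "x \<in> {M2, M1} \<union> range Lo \<union> range Hi" for x :: "'n idx"
    by (cases x) auto
  then show ?thesis by blast
qed

instance idx :: (finite) finite
  by standard (simp add: UNIV_idx)

type_synonym ('k, 'n) smat = "'k ^ 'n idx ^ 'n idx"

definition mscale :: "'k::field \<Rightarrow> ('k, 'n::finite) smat \<Rightarrow> ('k, 'n) smat"
  where "mscale c A = (\<chi> r s. c * A $ r $ s)"

interpretation smat: vector_space mscale
  by standard (auto simp: mscale_def vec_eq_iff algebra_simps)

definition E :: "'n idx \<Rightarrow> 'n idx \<Rightarrow> ('k::field, 'n::finite) smat"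
  where "E p q = (\<chi> r s. if r = p \<and> s = q then 1 else 0)"


subsection \<open>The supercommutator\<close>

text \<open>\<open>M2\<close> and \<open>M1\<close> have one parity, the remaining indices the other.\<close>

definition isotropic_idx :: "'n idx \<Rightarrow> bool"
  where "isotropic_idx r \<longleftrightarrow> r = M2 \<or> r = M1"

definition even_comp :: "('k::field, 'n::finite) smat \<Rightarrow> ('k, 'n) smat"
  where "even_comp A = (\<chi> r s. if isotropic_idx r = isotropic_idx s then A $ r $ s else 0)"

definition odd_comp :: "('k::field, 'n::finite) smat \<Rightarrow> ('k, 'n) smat"
  where "odd_comp A = (\<chi> r s. if isotropic_idx r = isotropic_idx s then 0 else A $ r $ s)"

text \<open>
  The bilinear extension of \<open>[A, B] = A B - (-1)^{|A| |B|} B A\<close> on homogeneous matrices.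
\<close>

definition superbracket :: "('k::field, 'n::finite) smat \<Rightarrow> ('k, 'n) smat \<Rightarrow> ('k, 'n) smat"
  where "superbracket A B =
     (even_comp A ** even_comp B - even_comp B ** even_comp A)
   + (even_comp A ** odd_comp B - odd_comp B ** even_comp A)
   + (odd_comp A ** even_comp B - even_comp B ** odd_comp A)
   + (odd_comp A ** odd_comp B + odd_comp B ** odd_comp A)"


subsection \<open>The Lie superalgebra \<open>osp(2|2n)\<close>\<close>

fun osp_entry ::
  "'k::field \<Rightarrow> 'k ^ 'n \<Rightarrow> 'k ^ 'n \<Rightarrow> 'k ^ 'n \<Rightarrow> 'k ^ 'n \<Rightarrow>
   'k ^ 'n ^ 'n \<Rightarrow> 'k ^ 'n ^ 'n \<Rightarrow> 'k ^ 'n ^ 'n \<Rightarrow> 'n::finite idx \<Rightarrow> 'n idx \<Rightarrow> 'k"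
where
  "osp_entry a x x1 y y1 d e f M2 M2 = a"
| "osp_entry a x x1 y y1 d e f M2 M1 = 0"
| "osp_entry a x x1 y y1 d e f M2 (Lo j) = x $ j"
| "osp_entry a x x1 y y1 d e f M2 (Hi j) = x1 $ j"
| "osp_entry a x x1 y y1 d e f M1 M2 = 0"
| "osp_entry a x x1 y y1 d e f M1 M1 = - a"
| "osp_entry a x x1 y y1 d e f M1 (Lo j) = y $ j"
| "osp_entry a x x1 y y1 d e f M1 (Hi j) = y1 $ j"
| "osp_entry a x x1 y y1 d e f (Lo i) M2 = y1 $ i"
| "osp_entry a x x1 y y1 d e f (Lo i) M1 = x1 $ i"
| "osp_entry a x x1 y y1 d e f (Lo i) (Lo j) = d $ i $ j"
| "osp_entry a x x1 y y1 d e f (Lo i) (Hi j) = e $ i $ j"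
| "osp_entry a x x1 y y1 d e f (Hi i) M2 = - (y $ i)"
| "osp_entry a x x1 y y1 d e f (Hi i) M1 = - (x $ i)"
| "osp_entry a x x1 y y1 d e f (Hi i) (Lo j) = f $ i $ j"
| "osp_entry a x x1 y y1 d e f (Hi i) (Hi j) = - (transpose d $ i $ j)"

definition osp_matrix ::
  "'k::field \<Rightarrow> 'k ^ 'n \<Rightarrow> 'k ^ 'n \<Rightarrow> 'k ^ 'n \<Rightarrow> 'k ^ 'n \<Rightarrow>
   'k ^ 'n ^ 'n \<Rightarrow> 'k ^ 'n ^ 'n \<Rightarrow> 'k ^ 'n ^ 'n \<Rightarrow> ('k, 'n::finite) smat"
  where "osp_matrix a x x1 y y1 d e f = (\<chi> r s. osp_entry a x x1 y y1 d e f r s)"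

definition osp :: "('k::field, 'n::finite) smat set"
  where "osp = {osp_matrix a x x1 y y1 d e f | a x x1 y y1 d e f.
                  transpose e = e \<and> transpose f = f}"

definition osp_even :: "('k::field, 'n::finite) smat set"
  where "osp_even = {osp_matrix a 0 0 0 0 d e f | a d e f. transpose e = e \<and> transpose f = f}"

definition osp_odd :: "('k::field, 'n::finite) smat set"
  where "osp_odd = {osp_matrix 0 x x1 y y1 0 0 0 | x x1 y y1. True}"


subsection \<open>The proposed basis\<close>

text \<open>\<open>E_{i,i} - E_{n+i,n+i}\<close>, the basis vector of the Cartan subalgebra dual to \<open>\<delta>_i\<close>\<close>

definition cartan_h :: "'n \<Rightarrow> ('k::field, 'n::finite) smat"
  where "cartan_h i = E (Lo i) (Lo i) - E (Hi i) (Hi i)"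

text \<open>
  Labels of the Chevalley basis of \<open>sp(2n)\<close>. \<open>Coroot i\<close> is the coroot of \<open>\<delta>_i - \<delta>_{i+1}\<close> if \<open>i\<close>
  is not the greatest index, and that of \<open>2 \<delta>_n\<close> otherwise. The other labels stand for the roots
  \<open>\<delta>_i - \<delta>_j\<close>, \<open>\<delta>_i + \<delta>_j\<close>, \<open>-\<delta>_i - \<delta>_j\<close>, \<open>2 \<delta>_i\<close> and \<open>-2 \<delta>_i\<close>, in this order.
\<close>

datatype 'n sp_label =
  Coroot 'n | Diff 'n 'n | Plus 'n 'n | Minus 'n 'n | LongPos 'n | LongNeg 'n

definition sp_labels :: "'n::{finite,linorder} sp_label set"
  where "sp_labels = range Coroot \<union> {Diff i j | i j. i \<noteq> j}
     \<union> {Plus i j | i j. i < j} \<union> {Minus i j | i j. i < j} \<union> range LongPos \<union> range LongNeg"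

definition next_idx :: "'n::{finite,linorder} \<Rightarrow> 'n"
  where "next_idx i = Min {j. i < j}"

fun chevalley :: "'n sp_label \<Rightarrow> ('k::field, 'n::{finite,linorder}) smat" where
  "chevalley (Coroot i) =
     (if i = Max UNIV then cartan_h i else cartan_h i - cartan_h (next_idx i))"
| "chevalley (Diff i j) = E (Lo i) (Lo j) - E (Hi j) (Hi i)"
| "chevalley (Plus i j) = E (Lo i) (Hi j) + E (Lo j) (Hi i)"
| "chevalley (Minus i j) = E (Hi i) (Lo j) + E (Hi j) (Lo i)"
| "chevalley (LongPos i) = E (Lo i) (Hi i)"
| "chevalley (LongNeg i) = E (Hi i) (Lo i)"

text \<open>
  The odd roots \<open>\<delta>_{-1} + \<delta>_j\<close>, \<open>-\<delta>_{-1} - \<delta>_j\<close>, \<open>\<delta>_{-1} - \<delta>_j\<close>, \<open>-\<delta>_{-1} + \<delta>_j\<close>, in this order.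
\<close>

datatype 'n odd_root = RootPP 'n | RootMM 'n | RootPM 'n | RootMP 'n

fun odd_root_vector :: "'n odd_root \<Rightarrow> ('k::field, 'n::finite) smat" where
  "odd_root_vector (RootPP j) = E M2 (Hi j) + E (Lo j) M1"
| "odd_root_vector (RootMM j) = E (Hi j) M2 - E M1 (Lo j)"
| "odd_root_vector (RootPM j) = E M2 (Lo j) - E (Hi j) M1"
| "odd_root_vector (RootMP j) = E M1 (Hi j) + E (Lo j) M2"

datatype 'n label = Sp "'n sp_label" | So | Odd "'n odd_root"

definition labels :: "'n::{finite,linorder} label set"
  where "labels = Sp ` sp_labels \<union> {So} \<union> range Odd"

fun basis_elt :: "'n label \<Rightarrow> ('k::field, 'n::{finite,linorder}) smat" where
  "basis_elt (Sp l) = chevalley l"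
| "basis_elt So = E M2 M2 - E M1 M1"
| "basis_elt (Odd r) = odd_root_vector r"


subsection \<open>Sanity checks\<close>

lemma osp_iff:
  "A \<in> osp \<longleftrightarrow>
     A $ M2 $ M1 = 0 \<and> A $ M1 $ M2 = 0 \<and> A $ M1 $ M1 = - A $ M2 $ M2 \<and>
     (\<forall>i. A $ Lo i $ M2 = A $ M1 $ Hi i \<and> A $ Lo i $ M1 = A $ M2 $ Hi i \<and>
          A $ Hi i $ M2 = - A $ M1 $ Lo i \<and> A $ Hi i $ M1 = - A $ M2 $ Lo i) \<and>
     (\<forall>i j. A $ Hi i $ Hi j = - A $ Lo j $ Lo i \<and> A $ Lo i $ Hi j = A $ Lo j $ Hi i \<and>
          A $ Hi i $ Lo j = A $ Hi j $ Lo i)" (is "_ \<longleftrightarrow> ?R")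
proof
  assume "A \<in> osp"
  then show ?R
    by (auto simp: osp_def osp_matrix_def transpose_def vec_eq_iff)
next
  assume R: ?R
  have ent: "A $ r $ s = osp_entry (A $ M2 $ M2) (\<chi> j. A $ M2 $ Lo j) (\<chi> j. A $ M2 $ Hi j)
      (\<chi> j. A $ M1 $ Lo j) (\<chi> j. A $ M1 $ Hi j) (\<chi> i j. A $ Lo i $ Lo j)
      (\<chi> i j. A $ Lo i $ Hi j) (\<chi> i j. A $ Hi i $ Lo j) r s" for r s
    using R by (cases r; cases s; simp add: transpose_def)
  show "A \<in> osp"
    unfolding osp_def mem_Collect_eq
    apply (rule exI[of _ "A $ M2 $ M2"], rule exI[of _ "\<chi> j. A $ M2 $ Lo j"],
        rule exI[of _ "\<chi> j. A $ M2 $ Hi j"], rule exI[of _ "\<chi> j. A $ M1 $ Lo j"],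
        rule exI[of _ "\<chi> j. A $ M1 $ Hi j"], rule exI[of _ "\<chi> i j. A $ Lo i $ Lo j"],
        rule exI[of _ "\<chi> i j. A $ Lo i $ Hi j"], rule exI[of _ "\<chi> i j. A $ Hi i $ Lo j"])
    using R by (simp add: osp_matrix_def vec_eq_iff transpose_def ent[symmetric])
qed

lemma osp_subspace: "smat.subspace osp"
  by (rule smat.subspaceI) (auto simp: osp_iff mscale_def)

lemma all_idx: "(\<forall>r. P r) \<longleftrightarrow> P M2 \<and> P M1 \<and> (\<forall>i. P (Lo i)) \<and> (\<forall>i. P (Hi i))"
  by (metis idx.exhaust)

lemma sum_idx:
  "(\<Sum>r\<in>UNIV. g r) = g M2 + g M1 + (\<Sum>i\<in>UNIV. g (Lo i)) + (\<Sum>i\<in>UNIV. g (Hi i))"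
  for g :: "'n::finite idx \<Rightarrow> 'b::comm_monoid_add"
proof -
  have "(\<Sum>r\<in>UNIV. g r) = (\<Sum>r\<in>{M2, M1} \<union> range Lo. g r) + (\<Sum>r\<in>range Hi. g r)"
    unfolding UNIV_idx by (rule sum.union_disjoint) auto
  also have "(\<Sum>r\<in>{M2, M1} \<union> range Lo. g r) = (\<Sum>r\<in>{M2, M1}. g r) + (\<Sum>r\<in>range Lo. g r)"
    by (rule sum.union_disjoint) auto
  finally show ?thesis
    by (simp add: sum.reindex inj_on_def)
qed

lemma superbracket_osp:
  assumes "A \<in> osp" "B \<in> osp"
  shows "superbracket A B \<in> osp"
  using assms unfolding osp_iff superbracket_def even_comp_def odd_comp_def isotropic_idx_def
  by (auto simp: matrix_matrix_mult_def sum_idx sum_negf mult.commute)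

lemma osp_even_odd:
  "osp_even = {A \<in> osp :: ('k::field, 'n::finite) smat set. odd_comp A = 0}"
  "osp_odd = {A \<in> osp :: ('k, 'n) smat set. even_comp A = 0}"
proof -
  have even: "odd_comp (osp_matrix a x x1 y y1 d e f) = 0 \<longleftrightarrow> x = 0 \<and> x1 = 0 \<and> y = 0 \<and> y1 = 0"
    for a :: 'k and x x1 y y1 :: "'k ^ 'n" and d e f
    by (auto simp: vec_eq_iff all_idx odd_comp_def isotropic_idx_def osp_matrix_def)
  have odd: "even_comp (osp_matrix a x x1 y y1 d e f) = 0 \<longleftrightarrow> a = 0 \<and> d = 0 \<and> e = 0 \<and> f = 0"
    for a :: 'k and x x1 y y1 :: "'k ^ 'n" and d e f
    by (auto simp: vec_eq_iff all_idx even_comp_def isotropic_idx_def osp_matrix_def transpose_def)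
  have t0: "transpose (0 :: 'k ^ 'n ^ 'n) = 0"
    by (simp add: transpose_def vec_eq_iff)
  show "osp_even = {A \<in> osp :: ('k, 'n) smat set. odd_comp A = 0}"
  proof (intro equalityI subsetI)
    fix A :: "('k, 'n) smat"
    assume "A \<in> osp_even"
    then obtain a d e f where "A = osp_matrix a 0 0 0 0 d e f" "transpose e = e" "transpose f = f"
      unfolding osp_even_def by blast
    then show "A \<in> {A \<in> osp. odd_comp A = 0}"
      unfolding osp_def using even[of a 0 0 0 0 d e f] by blast
  next
    fix A :: "('k, 'n) smat"
    assume "A \<in> {A \<in> osp. odd_comp A = 0}"
    then show "A \<in> osp_even"
      unfolding osp_def osp_even_def by (force simp: even)
  qed
  show "osp_odd = {A \<in> osp :: ('k, 'n) smat set. even_comp A = 0}"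
  proof (intro equalityI subsetI)
    fix A :: "('k, 'n) smat"
    assume "A \<in> osp_odd"
    then obtain x x1 y y1 where "A = osp_matrix 0 x x1 y y1 0 0 0"
      unfolding osp_odd_def by blast
    then show "A \<in> {A \<in> osp. even_comp A = 0}"
      unfolding osp_def using odd[of 0 x x1 y y1 0 0 0] t0 by blast
  next
    fix A :: "('k, 'n) smat"
    assume "A \<in> {A \<in> osp. even_comp A = 0}"
    then show "A \<in> osp_odd"
      unfolding osp_def osp_odd_def by (force simp: odd)
  qed
qed

lemma basis_elt_homogeneous:
  "basis_elt (Sp l) \<in> (osp_even :: ('k::field, 'n::{finite,linorder}) smat set)"
  "basis_elt So \<in> (osp_even :: ('k, 'n) smat set)"
  "basis_elt (Odd r) \<in> (osp_odd :: ('k, 'n) smat set)"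
proof -
  have ev: "A \<in> osp_even" if "A \<in> osp" "odd_comp A = 0" for A :: "('k, 'n) smat"
    using that by (simp add: osp_even_odd)
  have od: "A \<in> osp_odd" if "A \<in> osp" "even_comp A = 0" for A :: "('k, 'n) smat"
    using that by (simp add: osp_even_odd)
  have h: "cartan_h i \<in> (osp :: ('k, 'n) smat set)" for i
    unfolding osp_iff by (auto simp: cartan_h_def E_def)
  have "chevalley l \<in> (osp :: ('k, 'n) smat set)"
  proof (cases l)
    case (Coroot i)
    then show ?thesis
      using h smat.subspace_diff[OF osp_subspace h h, of i "next_idx i"]
      by simp
  qed (simp_all add: osp_iff E_def conj_commute add.commute)
  moreover have "odd_comp (chevalley l) = (0 :: ('k, 'n) smat)"
    by (cases l)
      (simp_all add: vec_eq_iff all_idx odd_comp_def isotropic_idx_def cartan_h_def E_def)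
  ultimately show "basis_elt (Sp l) \<in> (osp_even :: ('k, 'n) smat set)"
    by (simp add: ev)
  show "basis_elt So \<in> (osp_even :: ('k, 'n) smat set)"
    by (rule ev)
      (simp_all add: osp_iff vec_eq_iff all_idx odd_comp_def isotropic_idx_def E_def)
  have "odd_root_vector r \<in> (osp :: ('k, 'n) smat set)"
    by (cases r) (simp_all add: osp_iff E_def)
  moreover have "even_comp (odd_root_vector r) = (0 :: ('k, 'n) smat)"
    by (cases r) (simp_all add: vec_eq_iff all_idx even_comp_def isotropic_idx_def E_def)
  ultimately show "basis_elt (Odd r) \<in> (osp_odd :: ('k, 'n) smat set)"
    by (simp add: od)
qed

definition cartan :: "'k \<Rightarrow> 'k ^ 'n \<Rightarrow> ('k::field, 'n::finite) smat"
  where "cartan a t = mscale a (E M2 M2 - E M1 M1) + (\<Sum>i\<in>UNIV. mscale (t $ i) (cartan_h i))"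

fun odd_root_value :: "'n odd_root \<Rightarrow> 'k \<Rightarrow> 'k ^ 'n \<Rightarrow> 'k::field" where
  "odd_root_value (RootPP j) a t = a + t $ j"
| "odd_root_value (RootMM j) a t = - a - t $ j"
| "odd_root_value (RootPM j) a t = a - t $ j"
| "odd_root_value (RootMP j) a t = - a + t $ j"

lemma cartan_nth:
  "cartan a t $ p $ q =
     (if p = q then case p of M2 \<Rightarrow> a | M1 \<Rightarrow> - a | Lo i \<Rightarrow> t $ i | Hi i \<Rightarrow> - t $ i else 0)"
proof (cases p; cases q)
  fix i j assume "p = Lo i" "q = Lo j"
  then show ?thesis
    by (cases "i = j")
      (simp_all add: cartan_def mscale_def cartan_h_def E_def if_distrib[of "\<lambda>x. _ * x"]
        sum.delta sum.delta' cong: if_cong, auto intro!: sum.neutral)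
next
  fix i j assume "p = Hi i" "q = Hi j"
  then show ?thesis
    by (cases "i = j")
      (simp_all add: cartan_def mscale_def cartan_h_def E_def if_distrib[of "\<lambda>x. _ * x"]
        if_distrib[of uminus] sum.delta sum.delta' cong: if_cong, auto intro!: sum.neutral)
qed (simp_all add: cartan_def mscale_def cartan_h_def E_def)

lemma odd_root_vector_weight:
  "superbracket (cartan a t) (odd_root_vector r :: ('k::field, 'n::finite) smat)
     = mscale (odd_root_value r a t) (odd_root_vector r)"
proof -
  have ev: "even_comp (cartan a t) = cartan a t" "odd_comp (cartan a t) = 0"
    by (auto simp: even_comp_def odd_comp_def vec_eq_iff cartan_nth)
  have od: "odd_comp (odd_root_vector r) = (odd_root_vector r :: ('k, 'n) smat)"
    "even_comp (odd_root_vector r) = (0 :: ('k, 'n) smat)"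
    by (cases r; simp add: even_comp_def odd_comp_def isotropic_idx_def vec_eq_iff all_idx E_def)+
  have z: "A ** 0 = 0" "0 ** A = 0" for A :: "('k, 'n) smat"
    by (simp_all add: matrix_matrix_mult_def vec_eq_iff)
  have l: "(cartan a t ** B) $ p $ q = cartan a t $ p $ p * B $ p $ q" for B :: "('k, 'n) smat" and p q
    unfolding matrix_matrix_mult_def vec_lambda_beta
    by (subst sum.mono_neutral_right[of _ "{p}"]) (simp_all add: cartan_nth)
  have r: "(B ** cartan a t) $ p $ q = B $ p $ q * cartan a t $ q $ q" for B :: "('k, 'n) smat" and p q
    unfolding matrix_matrix_mult_def vec_lambda_beta
    by (subst sum.mono_neutral_right[of _ "{q}"]) (simp_all add: cartan_nth)
  have "superbracket (cartan a t) (odd_root_vector r) $ p $ q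
      = (cartan a t $ p $ p - cartan a t $ q $ q) * odd_root_vector r $ p $ q" for p q
    by (simp add: superbracket_def ev od z l r algebra_simps)
  moreover have "(cartan a t $ p $ p - cartan a t $ q $ q) * odd_root_vector r $ p $ q
      = odd_root_value r a t * odd_root_vector r $ p $ q" for p q
    by (cases r; cases p; cases q; simp add: E_def cartan_nth)
  ultimately show ?thesis
    by (simp add: vec_eq_iff mscale_def)
qed

end

theory Submission
  imports Defs
begin

text \<open>
  Every matrix in \<open>osp(2|2n)\<close> is determined by the entries that its block form leaves free, and up
  to a triangular change of coordinates on the Cartan part each proposed basis vector is
  responsible for exactly one of these entries. This gives coordinate functionals
  \<open>osp_coord _ l\<close>, one for each label \<open>l\<close>, which are dual to the proposed vectors
  (\<open>osp_coord_basis_elt\<close>) and separate the points of \<open>osp\<close> (\<open>osp_coord_separates\<close>). Duality gives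
  injectivity and independence. Duality and separation together give the expansion
  \<open>A = (\<Sum>l\<in>labels. osp_coord A l \<cdot> basis_elt l)\<close> on \<open>osp\<close> (\<open>osp_expansion\<close>), hence spanning.

  No table of structure constants is needed. The functionals are sums of entries, so a matrix of
  \<open>osp\<close> whose entries are integers (in the image of the integers in the field) has
  integer coordinates. The basis vectors have entries in \<open>{0, 1, -1}\<close>, and the superbracket
  preserves both \<open>osp\<close> and integrality of the entries, so all structure constants are integers.
\<close>

section \<open>Coordinates dual to the basis\<close>

text \<open>
  If the Cartan part of \<open>A\<close> is \<open>\<Sum>i. t\<^sub>i (E\<^sub>i\<^sub>,\<^sub>i - E\<^sub>n\<^sub>+\<^sub>i\<^sub>,\<^sub>n\<^sub>+\<^sub>i)\<close>, then
  Abel summation rewrites it with the partial sums \<open>t\<^sub>1 + \<dots> + t\<^sub>i\<close> as coefficients of the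
  simple coroots.
\<close>

fun osp_coord :: "('k::field, 'n::{finite,linorder}) smat \<Rightarrow> 'n label \<Rightarrow> 'k" where
  "osp_coord A (Sp (Coroot i)) = (\<Sum>k\<in>{..i}. A $ Lo k $ Lo k)"
| "osp_coord A (Sp (Diff i j)) = A $ Lo i $ Lo j"
| "osp_coord A (Sp (Plus i j)) = A $ Lo i $ Hi j"
| "osp_coord A (Sp (Minus i j)) = A $ Hi i $ Lo j"
| "osp_coord A (Sp (LongPos i)) = A $ Lo i $ Hi i"
| "osp_coord A (Sp (LongNeg i)) = A $ Hi i $ Lo i"
| "osp_coord A So = A $ M2 $ M2"
| "osp_coord A (Odd (RootPP j)) = A $ M2 $ Hi j"
| "osp_coord A (Odd (RootMM j)) = A $ Hi j $ M2"
| "osp_coord A (Odd (RootPM j)) = A $ M2 $ Lo j"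
| "osp_coord A (Odd (RootMP j)) = A $ M1 $ Hi j"

lemma osp_coord_zero [simp]: "osp_coord (0 :: ('k::field, 'n::{finite,linorder}) smat) l = 0"
  by (induction "0 :: ('k, 'n) smat" l rule: osp_coord.induct) simp_all

lemma osp_coord_diff: "osp_coord (A - B) l = osp_coord A l - osp_coord B l"
  by (induction A l rule: osp_coord.induct) (simp_all add: sum_subtractf)

lemma osp_coord_add: "osp_coord (A + B) l = osp_coord A l + osp_coord B l"
  by (induction A l rule: osp_coord.induct) (simp_all add: sum.distrib)

lemma osp_coord_mscale: "osp_coord (mscale c A) l = c * osp_coord A l"
  by (induction A l rule: osp_coord.induct) (simp_all add: mscale_def sum_distrib_left)

lemma osp_coord_sum: "osp_coord (\<Sum>x\<in>X. f x) l = (\<Sum>x\<in>X. osp_coord (f x) l)"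
  by (induction X rule: infinite_finite_induct) (simp_all add: osp_coord_add)

lemma next_idx_le_iff:
  assumes "i \<noteq> Max UNIV"
  shows "next_idx i \<le> m \<longleftrightarrow> i < m"
proof -
  have "i < Max UNIV"
    using assms by (simp add: order_less_le)
  then have "{j. i < j} \<noteq> {}"
    by blast
  then show ?thesis
    unfolding next_idx_def by (subst Min_le_iff) (auto intro: order.strict_trans2)
qed

lemma sum_cartan_h_diagonal:
  "(\<Sum>k\<in>{..m}. cartan_h i $ Lo k $ Lo k) = (if i \<le> m then 1 else 0 :: 'k::field)"
  for i m :: "'n::{finite,linorder}"
  by (simp add: cartan_h_def E_def)

text \<open>
  The sum of the diagonal entries \<open>k \<le> m\<close> of \<open>h\<^sub>i - h\<^sub>i\<^sub>+\<^sub>1\<close> telescopes: it is \<open>1\<close> exactly when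
  \<open>i \<le> m\<close> but not \<open>i + 1 \<le> m\<close>, that is, when \<open>m = i\<close>.
\<close>

lemma osp_coord_coroot:
  "osp_coord (chevalley (Coroot i) :: ('k::field, 'n::{finite,linorder}) smat) (Sp (Coroot m))
     = (if i = m then 1 else 0)"
proof (cases "i = Max UNIV")
  case True
  have "i \<le> m \<longleftrightarrow> i = m"
    using True by (auto intro: order.antisym)
  then show ?thesis
    using True by (simp add: sum_cartan_h_diagonal)
next
  case False
  then show ?thesis
    by (auto simp: sum_subtractf sum_cartan_h_diagonal next_idx_le_iff)
qed

lemma coroot_nth_eq_0:
  assumes "p \<noteq> q \<or> p = M2"
  shows "(chevalley (Coroot i) :: ('k::field, 'n::{finite,linorder}) smat) $ p $ q = 0"
proof -
  have "(cartan_h j :: ('k, 'n) smat) $ p $ q = 0" for j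
    using assms by (auto simp: cartan_h_def E_def)
  then show ?thesis
    by simp
qed

lemma mem_labels [simp]:
  "Sp (Coroot i) \<in> labels"
  "Sp (Diff i j) \<in> labels \<longleftrightarrow> i \<noteq> j"
  "Sp (Plus i j) \<in> labels \<longleftrightarrow> i < j"
  "Sp (Minus i j) \<in> labels \<longleftrightarrow> i < j"
  "Sp (LongPos i) \<in> labels"
  "Sp (LongNeg i) \<in> labels"
  "So \<in> labels"
  "Odd r \<in> labels"
  by (auto simp: labels_def sp_labels_def)

lemma label_cases [case_names Coroot Diff Plus Minus LongPos LongNeg So PP MM PM MP]:
  obtains i where "l = Sp (Coroot i)"
  | i j where "l = Sp (Diff i j)"
  | i j where "l = Sp (Plus i j)"
  | i j where "l = Sp (Minus i j)"
  | i where "l = Sp (LongPos i)"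
  | i where "l = Sp (LongNeg i)"
  | "l = So"
  | j where "l = Odd (RootPP j)"
  | j where "l = Odd (RootMM j)"
  | j where "l = Odd (RootPM j)"
  | j where "l = Odd (RootMP j)"
proof (cases l)
  case (Sp k)
  with that show thesis
    by (cases k) blast+
next
  case So
  with that show thesis
    by blast
next
  case (Odd r)
  with that show thesis
    by (cases r) blast+
qed

lemma basis_elt_diagonal_eq_0:
  assumes "l \<in> labels" "\<And>i. l \<noteq> Sp (Coroot i)"
  shows "basis_elt l $ Lo k $ Lo k = 0"
  using assms by (cases l rule: label_cases) (simp_all add: E_def del: chevalley.simps(1), auto)

text \<open>
  An entry of \<open>E\<^sub>i\<^sub>j + E\<^sub>j\<^sub>i\<close>, with \<open>i < j\<close>, in a position \<open>(a, b)\<close> above the diagonal: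
  only the first matrix unit can contribute. This covers both symmetric blocks.
\<close>

lemma transposed_deltas:
  fixes i j a b :: "'n::linorder"
  assumes "i < j" "a < b"
  shows "(if a = i \<and> b = j then 1 else 0) + (if a = j \<and> b = i then 1 else 0)
           = (if i = a \<and> j = b then 1 else (0 :: 'k::field))"
proof -
  have "\<not> (a = j \<and> b = i)"
    using assms by auto
  then show ?thesis
    by (auto simp del: de_Morgan_conj)
qed

text \<open>
  Both labels have to be restricted to \<open>labels\<close>: \<open>Diff i i\<close> and, for \<open>i < j\<close>, \<open>Plus j i\<close>
  read off entries of other basis vectors, and \<open>Plus j i\<close> names the same matrix as \<open>Plus i j\<close>.
\<close>

lemma osp_coord_basis_elt:
  assumes "l \<in> labels" "m \<in> labels"
  shows "osp_coord (basis_elt l :: ('k::field, 'n::{finite,linorder}) smat) m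
           = (if l = m then 1 else 0)"
proof (cases "\<exists>j. m = Sp (Coroot j)")
  case True
  then obtain j where m: "m = Sp (Coroot j)"
    by blast
  show ?thesis
  proof (cases "\<exists>i. l = Sp (Coroot i)")
    case True
    then obtain i where "l = Sp (Coroot i)"
      by blast
    then show ?thesis
      using m osp_coord_coroot[of i j, where 'k = 'k]
      by (simp del: chevalley.simps osp_coord.simps)
  next
    case False
    then show ?thesis
      using m assms(1) by (auto simp: basis_elt_diagonal_eq_0)
  qed
next
  case False
  with assms show ?thesis
    by (cases l rule: label_cases; cases m rule: label_cases)
      (simp_all add: E_def coroot_nth_eq_0 transposed_deltas del: chevalley.simps(1), auto)
qed

section \<open>Expansion of the matrices of the superalgebra\<close>

lemma eq_0_if_partial_sums_eq_0:
  fixes t :: "'n::{finite,linorder} \<Rightarrow> 'a::comm_monoid_add"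
  assumes "\<And>i. (\<Sum>k\<in>{..i}. t k) = 0"
  shows "t i = 0"
  \<comment> \<open>A finite linear order is well-founded: the number of smaller elements is a measure.\<close>
proof (induction i rule: measure_induct_rule[of "\<lambda>i. card {..<i}"])
  case (less i)
  have "t k = 0" if "k < i" for k
    using that by (intro less psubset_card_mono) auto
  then have "(\<Sum>k\<in>{..<i}. t k) = 0"
    by simp
  moreover have "{..i} = insert i {..<i}"
    by auto
  ultimately show ?case
    using assms[of i] by simp
qed

text \<open>
  The functionals see the free entries of the block form, apart from half of each symmetric block,
  and see the diagonal only through partial sums; membership in \<open>osp\<close> supplies all remaining
  entries.
\<close>

lemma osp_coord_separates:
  assumes A: "A \<in> (osp :: ('k::field, 'n::{finite,linorder}) smat set)"
    and zero: "\<And>l. l \<in> labels \<Longrightarrow> osp_coord A l = 0"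
  shows "A = 0"
proof -
  have so: "A $ M2 $ M2 = 0"
    using zero[of So] by simp
  have odd: "A $ M2 $ Hi j = 0" "A $ Hi j $ M2 = 0" "A $ M2 $ Lo j = 0" "A $ M1 $ Hi j = 0" for j
    using zero[of "Odd (RootPP j)"] zero[of "Odd (RootMM j)"]
      zero[of "Odd (RootPM j)"] zero[of "Odd (RootMP j)"] by simp_all
  have "(\<Sum>k\<in>{..i}. A $ Lo k $ Lo k) = 0" for i
    using zero[of "Sp (Coroot i)"] by simp
  then have "A $ Lo i $ Lo i = 0" for i
    by (rule eq_0_if_partial_sums_eq_0)
  then have d: "A $ Lo i $ Lo j = 0" for i j
    using zero[of "Sp (Diff i j)"] by (cases "i = j") auto
  have ef_le: "A $ Lo i $ Hi j = 0 \<and> A $ Hi i $ Lo j = 0" if "i \<le> j" for i j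
  proof (cases "i = j")
    case True
    then show ?thesis
      using zero[of "Sp (LongPos i)"] zero[of "Sp (LongNeg i)"] by simp
  next
    case False
    with that show ?thesis
      using zero[of "Sp (Plus i j)"] zero[of "Sp (Minus i j)"] by simp
  qed
  \<comment> \<open>The entries above the diagonal of the symmetric blocks determine those below it.\<close>
  have ef: "A $ Lo i $ Hi j = 0" "A $ Hi i $ Lo j = 0" for i j
    using ef_le[of i j] ef_le[of j i] A unfolding osp_iff by (cases i j rule: le_cases; simp)+
  from A show ?thesis
    unfolding osp_iff vec_eq_iff all_idx
    by (auto simp: so odd d ef neg_eq_iff_add_eq_0)
qed

lemma finite_labels: "finite (labels :: 'n::{finite,linorder} label set)"
proof -
  have "{Diff i j | i j. i \<noteq> j} \<subseteq> range (\<lambda>(i, j). Diff i (j :: 'n))"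
    "{Plus i j | i j. i < j} \<subseteq> range (\<lambda>(i, j). Plus i (j :: 'n))"
    "{Minus i j | i j. i < j} \<subseteq> range (\<lambda>(i, j). Minus i (j :: 'n))"
    by auto
  then have "finite (sp_labels :: 'n sp_label set)"
    unfolding sp_labels_def by (simp add: finite_subset)
  moreover have "finite (range Odd :: 'n label set)"
  proof (rule finite_subset)
    let ?R = "range RootPP \<union> range RootMM \<union> range RootPM \<union> range RootMP :: 'n odd_root set"
    have "r \<in> ?R" for r
      by (cases r) auto
    then show "range Odd \<subseteq> Odd ` ?R"
      by blast
    show "finite (Odd ` ?R)"
      by simp
  qed
  ultimately show ?thesis
    by (simp add: labels_def)
qed

lemma basis_elt_in_osp: "basis_elt l \<in> (osp :: ('k::field, 'n::{finite,linorder}) smat set)"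
  using basis_elt_homogeneous by (cases l) (auto simp: osp_even_odd)

lemma osp_coord_combination:
  assumes "m \<in> labels"
  shows "osp_coord (\<Sum>l\<in>labels. mscale (c l) (basis_elt l)
           :: ('k::field, 'n::{finite,linorder}) smat) m = c m"
proof -
  have "osp_coord (\<Sum>l\<in>labels. mscale (c l) (basis_elt l) :: ('k, 'n) smat) m
      = (\<Sum>l\<in>labels. if l = m then c l else 0)"
    unfolding osp_coord_sum osp_coord_mscale
    by (rule sum.cong) (simp_all add: osp_coord_basis_elt assms)
  then show ?thesis
    using assms by (simp add: finite_labels)
qed

text \<open>
  The difference of the two sides lies in \<open>osp\<close> and, by duality, all its coordinates vanish, so no
  sum over the labels has to be evaluated entry by entry.
\<close>

lemma osp_expansion:
  assumes "A \<in> (osp :: ('k::field, 'n::{finite,linorder}) smat set)"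
  shows "A = (\<Sum>l\<in>labels. mscale (osp_coord A l) (basis_elt l))" (is "A = ?S")
proof -
  have "?S \<in> osp"
    by (intro smat.subspace_sum smat.subspace_scale osp_subspace basis_elt_in_osp)
  then have "A - ?S \<in> osp"
    using assms by (intro smat.subspace_diff osp_subspace)
  then have "A - ?S = 0"
    by (rule osp_coord_separates) (simp add: osp_coord_diff osp_coord_combination)
  then show ?thesis
    by simp
qed

section \<open>Integral matrices\<close>

text \<open>
  Here \<open>\<int>\<close> is the image of the integers in the field, which in characteristic \<open>p\<close> is the prime
  field; integer coefficients are recovered by lifting, one coordinate at a time.
\<close>

definition integral_matrix :: "('k::field, 'n::finite) smat \<Rightarrow> bool"
  where "integral_matrix A \<longleftrightarrow> (\<forall>p q. A $ p $ q \<in> \<int>)"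

lemma integral_matrix_superbracket:
  fixes A B :: "('k::field, 'n::finite) smat"
  assumes "integral_matrix A" "integral_matrix B"
  shows "integral_matrix (superbracket A B)"
proof -
  have parts: "integral_matrix (even_comp C)" "integral_matrix (odd_comp C)"
    if "integral_matrix C" for C :: "('k, 'n) smat"
    using that by (simp_all add: integral_matrix_def even_comp_def odd_comp_def)
  have mult: "integral_matrix (C ** D)" if "integral_matrix C" "integral_matrix D"
    for C D :: "('k, 'n) smat"
    using that by (auto simp: integral_matrix_def matrix_matrix_mult_def intro!: Ints_sum Ints_mult)
  have add: "integral_matrix (C + D)" and diff: "integral_matrix (C - D)"
    if "integral_matrix C" "integral_matrix D" for C D :: "('k, 'n) smat"
    using that by (auto simp: integral_matrix_def)
  show ?thesis
    unfolding superbracket_def by (intro add diff mult parts assms)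
qed

lemma integral_matrix_basis_elt:
  "integral_matrix (basis_elt l :: ('k::field, 'n::{finite,linorder}) smat)"
proof -
  have E: "(E p q :: ('k, 'n) smat) $ r $ s \<in> \<int>" for p q r s
    by (simp add: E_def)
  have "integral_matrix (chevalley k :: ('k, 'n) smat)" for k
    by (cases k) (auto simp: integral_matrix_def cartan_h_def intro!: Ints_add Ints_diff E)
  moreover have "integral_matrix (odd_root_vector k :: ('k, 'n) smat)" for k
    by (cases k) (auto simp: integral_matrix_def intro!: Ints_add Ints_diff E)
  moreover have "integral_matrix (E M2 M2 - E M1 M1 :: ('k, 'n) smat)"
    by (auto simp: integral_matrix_def intro!: Ints_diff E)
  ultimately show ?thesis
    by (cases l) auto
qed

text \<open>
  The coordinates involve no division: the coefficient of a long root vector is a diagonal entry of a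
  symmetric block itself, even though that of a short one occurs twice in the matrix.
\<close>

lemma osp_coord_integral:
  assumes "integral_matrix A"
  shows "osp_coord A l \<in> \<int>"
  using assms by (induction A l rule: osp_coord.induct) (auto simp: integral_matrix_def)

section \<open>The basis theorem\<close>

theorem proposition3p4:
  assumes "CHAR('k::field) \<noteq> 2"
  shows "inj_on (basis_elt :: 'n::{finite,linorder} label \<Rightarrow> ('k, 'n) smat) labels \<and>
     smat.independent (basis_elt ` labels :: ('k, 'n) smat set) \<and>
     smat.span (basis_elt ` labels) = (osp :: ('k, 'n) smat set) \<and>
     (\<forall>l\<in>labels. \<forall>m\<in>labels. \<exists>c :: 'n label \<Rightarrow> int.
        superbracket (basis_elt l) (basis_elt m :: ('k, 'n) smat)
          = (\<Sum>r\<in>labels. mscale (of_int (c r)) (basis_elt r)))"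
proof (intro conjI ballI)
  show inj: "inj_on (basis_elt :: 'n label \<Rightarrow> ('k, 'n) smat) labels"
  proof (rule inj_onI)
    fix l m :: "'n label"
    assume "l \<in> labels" "m \<in> labels" "basis_elt l = (basis_elt m :: ('k, 'n) smat)"
    then show "l = m"
      using osp_coord_basis_elt[of l m, where 'k = 'k] osp_coord_basis_elt[of m m, where 'k = 'k]
      by (auto split: if_splits)
  qed
  show "smat.independent (basis_elt ` labels :: ('k, 'n) smat set)"
  proof
    assume "smat.dependent (basis_elt ` labels :: ('k, 'n) smat set)"
    then obtain u l where l: "l \<in> labels" "u (basis_elt l :: ('k, 'n) smat) \<noteq> 0"
      and "(\<Sum>v\<in>basis_elt ` labels. mscale (u v) v) = (0 :: ('k, 'n) smat)"
      by (subst (asm) smat.dependent_finite) (auto simp: finite_labels)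
    then have "(\<Sum>l\<in>labels. mscale (u (basis_elt l)) (basis_elt l)) = (0 :: ('k, 'n) smat)"
      by (simp add: sum.reindex[OF inj])
    then show False
      using l osp_coord_combination[OF l(1), of "\<lambda>l. u (basis_elt l)"] by simp
  qed
  show "smat.span (basis_elt ` labels) = (osp :: ('k, 'n) smat set)"
  proof
    show "smat.span (basis_elt ` labels) \<subseteq> (osp :: ('k, 'n) smat set)"
      by (rule smat.span_minimal) (auto intro: basis_elt_in_osp osp_subspace)
    show "osp \<subseteq> smat.span (basis_elt ` labels :: ('k, 'n) smat set)"
    proof
      fix A :: "('k, 'n) smat"
      assume "A \<in> osp"
      then have "A = (\<Sum>l\<in>labels. mscale (osp_coord A l) (basis_elt l))"
        by (rule osp_expansion)
      moreover have "(\<Sum>l\<in>labels. mscale (osp_coord A l) (basis_elt l))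
          \<in> smat.span (basis_elt ` labels)"
        by (intro smat.span_sum smat.span_scale smat.span_base imageI)
      ultimately show "A \<in> smat.span (basis_elt ` labels)"
        by simp
    qed
  qed
  fix l m :: "'n label"
  let ?B = "superbracket (basis_elt l) (basis_elt m) :: ('k, 'n) smat"
  have "osp_coord ?B r \<in> \<int>" for r
    by (intro osp_coord_integral integral_matrix_superbracket integral_matrix_basis_elt)
  then have "\<exists>c. \<forall>r. osp_coord ?B r = of_int (c r)"
    by (intro choice) (auto elim: Ints_cases)
  then obtain c where "\<And>r. osp_coord ?B r = of_int (c r)"
    by blast
  moreover have "?B = (\<Sum>r\<in>labels. mscale (osp_coord ?B r) (basis_elt r))"
    by (intro osp_expansion superbracket_osp basis_elt_in_osp)
  ultimately have "?B = (\<Sum>r\<in>labels. mscale (of_int (c r)) (basis_elt r))"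
    by simp
  then show "\<exists>c :: 'n label \<Rightarrow> int. ?B = (\<Sum>r\<in>labels. mscale (of_int (c r)) (basis_elt r))"
    by blast
qed

end
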